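(* There is an absolute constant $C>0$ such that the following holds. Consider the problem $\min_{x\in\mathbb{R}^d}F(x)$, $F=f+\psi$, where $F$ is bounded below by $F^\star\in\mathbb{R}$, $f$ is $L$-smooth, and the stochastic gradient oracle of $f$ is unbiased with variance at most $\sigma^2$. Let $\varepsilon>0$ be a target error, let $F_0:=F(x_0)-F^\star$ and $\Phi_0:=F_0+\sqrt{\frac{19}{156}}\,\frac{\mathbb{E}\|m_0-\nabla f(x_0)\|^2}{L}$, and assume $\Phi_0>0$. Then there is a number of iterations $$K=\mathcal{O}\Bigl(\frac{L\Phi_0\sigma^2}{\varepsilon^2}+\frac{L\Phi_0}{\varepsilon}\Bigr),\qquad\text{i.e. an integer } 1\le K\le\Bigl\lceil C\Bigl(\frac{L\Phi_0\sigma^2}{\varepsilon^2}+\frac{L\Phi_0}{\varepsilon}\Bigr)\Bigr\rceil,$$ such that, if the proximal gradient method with Polyak momentum is run for $K$ iterations with constant coefficients $M_k=M:=4L+\sqrt{\frac{8KL\sigma^2}{\Phi_0}}$ and $\gamma_k=\sqrt{\frac{152}{17}}\,\frac{L}{M-L}$ for $0\le k\le K-1$, and at each iteration $0\le k\le K-1$ the point $x_{k+1}$ satisfies $\Omega_k(x_{k+1})\le\Omega_k(x_k)$ together with the approximate stationarity condition $$\mathbb{E}\|\nabla\Omega_k(x_{k+1})\|^2\le\frac{M^2}{16}\mathbb{E}\|x_{k+1}-x_k\|^2+S_k$$ for some numbers $S_k\ge0$, then for $x_t$ chosen uniformly at random from $\{x_1,\dots,x_K\}$ (with $t$ independent of everything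 else) it holds that $$\mathbb{E}\|\nabla F(x_t)\|^2\le\frac{\varepsilon}{2}+\frac8K\sum_{k=0}^{K-1}S_k.$$ In particular, if $S_k\le\frac{\varepsilon}{16}$ for all $0\le k\le K-1$, then $\mathbb{E}\|\nabla F(x_t)\|^2\le\varepsilon$.
   Context: Setting. $d\ge1$, $L>0$, $\sigma\ge0$; $\|\cdot\|$ is the Euclidean norm. $f:\mathbb{R}^d\to\mathbb{R}$ and $\psi:\mathbb{R}^d\to\mathbb{R}$ are differentiable (convexity is not assumed), and $F:=f+\psi$. "$F$ is bounded below by $F^\star$" means $F^\star\le F(x)$ for all $x$. "$f$ is $L$-smooth" means $\|\nabla f(x)-\nabla f(y)\|\le L\|x-y\|$ for all $x,y$. "The oracle is unbiased with variance at most $\sigma^2$" means that a random vector $\nabla f(x,\xi)$ is available with $\mathbb{E}[\nabla f(x,\xi)]=\nabla f(x)$ and $\mathbb{E}\|\nabla f(x,\xi)-\nabla f(x)\|^2\le\sigma^2$ for every $x$. Proximal gradient method with Polyak momentum. Inputs: a deterministic $x_0\in\mathbb{R}^d$, a (possibly random) vector $m_{-1}$, deterministic $M_k>0$ ($k\ge0$) and $\gamma_k$ ($k\ge-1$). For $k=0,1,2,\dots$: compute $g_k=\nabla f(x_k,\xi_k)$ with a fresh sample $\xi_k$ (for each $k\ge0$, $\xi_{k+1}$ is independent of $x_0,\dots,x_{k+1},m_{-1},\dots,m_k$); set $m_k=(1-\gamma_{k-1})m_{k-1}+\gamma_{k-1}g_k$; with $\Omega_k(x):=\langle m_k,x\rangle+\psi(x)+\frac{M_k}{2}\|x-x_k\|^2$,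 compute a (random) approximate stationary point $x_{k+1}$ of $\Omega_k$ (the accuracy is as specified in the statement). *)

theory Defs
  imports "HOL-Analysis.Analysis" "HOL-Probability.Probability"
begin

definition gradient :: "('a::euclidean_space \<Rightarrow> real) \<Rightarrow> 'a \<Rightarrow> 'a"
  where "gradient f x = (THE D. GDERIV f x :> D)"

lemma gradient_eqI:
  assumes "GDERIV f x :> D"
  shows "gradient f x = D"
  unfolding gradient_def
proof (rule the_equality)
  show "GDERIV f x :> D" by fact
  fix D' assume "GDERIV f x :> D'"
  then have "(\<lambda>h. inner h D') = (\<lambda>h. inner h D)"
    using assms unfolding gderiv_def by (rule has_derivative_unique)
  then show "D' = D" by (metis inner_commute vector_eq_rdot)
qed

lemma GDERIV_gradient:
  assumes "f differentiable (at x)"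
  shows "GDERIV f x :> gradient f x"
proof -
  from assms obtain f' where f': "(f has_derivative f') (at x)"
    unfolding differentiable_def by blast
  then have "linear f'" using has_derivative_linear by blast
  then have "f' = (\<lambda>h. inner h (adjoint f' 1))"
    using adjoint_works[of f'] by (auto simp: fun_eq_iff)
  with f' have "GDERIV f x :> adjoint f' 1" unfolding gderiv_def by simp
  then show ?thesis using gradient_eqI by fastforce
qed

definition smooth_with :: "real \<Rightarrow> ('a::euclidean_space \<Rightarrow> real) \<Rightarrow> bool"
  where "smooth_with L f \<longleftrightarrow>
    (\<forall>x y. norm (gradient f x - gradient f y) \<le> L * norm (x - y))"

(* Expectations of squared norms are taken in [0, infinity], so a bound on such an expectation
   never holds because a divergent integral was set to 0. *)
definition mean_sq :: "'w measure \<Rightarrow> ('w \<Rightarrow> 'a::euclidean_space) \<Rightarrow> ennreal"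
  where "mean_sq P X = (\<integral>\<^sup>+ \<omega>. ennreal ((norm (X \<omega>))\<^sup>2) \<partial>P)"

(* G x s is the stochastic gradient at x for the sample s, and D is the law of the samples.
   Joint measurability makes G (x_k, xi_k) a random vector. *)
definition unbiased_oracle ::
  "'s measure \<Rightarrow> ('a::euclidean_space \<Rightarrow> 's \<Rightarrow> 'a) \<Rightarrow> ('a \<Rightarrow> real) \<Rightarrow> real \<Rightarrow> bool"
  where "unbiased_oracle D G f \<sigma> \<longleftrightarrow>
    prob_space D \<and> case_prod G \<in> borel_measurable (borel \<Otimes>\<^sub>M D) \<and>
    (\<forall>x. has_bochner_integral D (G x) (gradient f x)) \<and>
    (\<forall>x. mean_sq D (\<lambda>s. G x s - gradient f x) \<le> ennreal (\<sigma>\<^sup>2))"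

definition prox_model :: "('a::euclidean_space \<Rightarrow> real) \<Rightarrow> real \<Rightarrow> 'a \<Rightarrow> 'a \<Rightarrow> 'a \<Rightarrow> real"
  where "prox_model \<psi> M m xk x = inner m x + \<psi> x + M / 2 * (norm (x - xk))\<^sup>2"

(* g_init and m_init are the coefficient and the momentum with index -1. *)
primrec momentum ::
  "('a::euclidean_space \<Rightarrow> 's \<Rightarrow> 'a) \<Rightarrow> real \<Rightarrow> (nat \<Rightarrow> real) \<Rightarrow> ('w \<Rightarrow> 'a) \<Rightarrow>
   (nat \<Rightarrow> 'w \<Rightarrow> 's) \<Rightarrow> (nat \<Rightarrow> 'w \<Rightarrow> 'a) \<Rightarrow> nat \<Rightarrow> 'w \<Rightarrow> 'a"
  where
    "momentum G g_init \<gamma> m_init \<xi> x 0 =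
      (\<lambda>\<omega>. (1 - g_init) *\<^sub>R m_init \<omega> + g_init *\<^sub>R G (x 0 \<omega>) (\<xi> 0 \<omega>))"
  | "momentum G g_init \<gamma> m_init \<xi> x (Suc k) =
      (\<lambda>\<omega>. (1 - \<gamma> k) *\<^sub>R momentum G g_init \<gamma> m_init \<xi> x k \<omega>
           + \<gamma> k *\<^sub>R G (x (Suc k) \<omega>) (\<xi> (Suc k) \<omega>))"

(* The library's indep_var requires both random variables to have the same value type; this is the
   same condition for values of two types. *)
definition independent_rv ::
  "'w measure \<Rightarrow> 'b measure \<Rightarrow> ('w \<Rightarrow> 'b) \<Rightarrow> 'c measure \<Rightarrow> ('w \<Rightarrow> 'c) \<Rightarrow> bool"
  where "independent_rv P S X T Y \<longleftrightarrow>
    X \<in> measurable P S \<and> Y \<in> measurable P T \<and>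
    prob_space.indep_set P {X -` A \<inter> space P | A. A \<in> sets S} {Y -` B \<inter> space P | B. B \<in> sets T}"

definition history_space ::
  "nat set \<Rightarrow> nat set \<Rightarrow> ((nat \<Rightarrow> 'a::euclidean_space) \<times> 'a \<times> (nat \<Rightarrow> 'a)) measure"
  where "history_space I J = PiM I (\<lambda>_. borel) \<Otimes>\<^sub>M (borel \<Otimes>\<^sub>M PiM J (\<lambda>_. borel))"

definition history ::
  "nat set \<Rightarrow> nat set \<Rightarrow> (nat \<Rightarrow> 'w \<Rightarrow> 'a::euclidean_space) \<Rightarrow> ('w \<Rightarrow> 'a) \<Rightarrow> (nat \<Rightarrow> 'w \<Rightarrow> 'a) \<Rightarrow>
   'w \<Rightarrow> (nat \<Rightarrow> 'a) \<times> 'a \<times> (nat \<Rightarrow> 'a)"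
  where "history I J x m_init m \<omega> = (\<lambda>i\<in>I. x i \<omega>, m_init \<omega>, \<lambda>j\<in>J. m j \<omega>)"

(* K iterations on the probability space P.  How x_{k+1} is computed is left open here; apart from
   measurability it is constrained only through the accuracy conditions of the theorem. *)
definition momentum_run ::
  "'w measure \<Rightarrow> 's measure \<Rightarrow> ('a::euclidean_space \<Rightarrow> 's \<Rightarrow> 'a) \<Rightarrow> nat \<Rightarrow> real \<Rightarrow> (nat \<Rightarrow> real) \<Rightarrow>
   'a \<Rightarrow> ('w \<Rightarrow> 'a) \<Rightarrow> (nat \<Rightarrow> 'w \<Rightarrow> 's) \<Rightarrow> (nat \<Rightarrow> 'w \<Rightarrow> 'a) \<Rightarrow> bool"
  where "momentum_run P D G K g_init \<gamma> x0 m_init \<xi> x \<longleftrightarrow>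
    prob_space P \<and>
    m_init \<in> borel_measurable P \<and>
    (\<forall>\<omega>\<in>space P. x 0 \<omega> = x0) \<and>
    (\<forall>k\<le>K. x k \<in> borel_measurable P) \<and>
    (\<forall>k<K. \<xi> k \<in> measurable P D \<and> distr P D (\<xi> k) = D) \<and>
    (\<forall>k. Suc k < K \<longrightarrow>
      independent_rv P D (\<xi> (Suc k)) (history_space {..Suc k} {..k})
        (history {..Suc k} {..k} x m_init (momentum G g_init \<gamma> m_init \<xi> x)))"

(* Uniform on {1..K} and independent of all iterates, momenta and samples of the run. *)
definition uniform_independent_index ::
  "'w measure \<Rightarrow> 's measure \<Rightarrow> nat \<Rightarrow> (nat \<Rightarrow> 'w \<Rightarrow> 'a::euclidean_space) \<Rightarrow> ('w \<Rightarrow> 'a) \<Rightarrow>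
   (nat \<Rightarrow> 'w \<Rightarrow> 'a) \<Rightarrow> (nat \<Rightarrow> 'w \<Rightarrow> 's) \<Rightarrow> ('w \<Rightarrow> nat) \<Rightarrow> bool"
  where "uniform_independent_index P D K x m_init m \<xi> t \<longleftrightarrow>
    t \<in> measurable P (count_space UNIV) \<and>
    distr P (count_space UNIV) t = measure_pmf (pmf_of_set {1..K}) \<and>
    independent_rv P (count_space UNIV) t
      (history_space {..K} {..<K} \<Otimes>\<^sub>M PiM {..<K} (\<lambda>_. D))
      (\<lambda>\<omega>. (history {..K} {..<K} x m_init m \<omega>, \<lambda>k\<in>{..<K}. \<xi> k \<omega>))"

definition initial_potential ::
  "'w measure \<Rightarrow> ('a::euclidean_space \<Rightarrow> real) \<Rightarrow> ('a \<Rightarrow> real) \<Rightarrow> real \<Rightarrow> real \<Rightarrow> 'a \<Rightarrow> ('w \<Rightarrow> 'a) \<Rightarrow> real"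
  where "initial_potential P f \<psi> Fstar L x0 m0 =
    (f x0 + \<psi> x0 - Fstar)
      + sqrt (19 / 156) * (\<integral>\<omega>. (norm (m0 \<omega> - gradient f x0))\<^sup>2 \<partial>P) / L"

(* The absolute constant hidden in the O-notation.  It is an explicit number because an
   existentially quantified constant could depend on the type variables of the theorem, that is,
   on the dimension and on the sample spaces.  The value is not optimized. *)
definition iteration_constant :: real
  where "iteration_constant = 10 ^ 7"

end

theory Submission
  imports Defs
begin

text \<open>
  Two errors feed each other along the run: the momentum error
  \<open>e\<^sub>k = E \<parallel>m\<^sub>k - \<nabla>f x\<^sub>k\<parallel>\<^sup>2\<close> and the squared step \<open>r\<^sub>k = E \<parallel>x\<^sub>k\<^sub>+\<^sub>1 - x\<^sub>k\<parallel>\<^sup>2\<close>.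
  A proximal step decreases the mean gap \<open>E F x\<^sub>k - F\<^sup>\<star>\<close> by a multiple of \<open>r\<^sub>k\<close>, up to an error
  proportional to \<open>e\<^sub>k\<close>, because the model is built with \<open>m\<^sub>k\<close> instead of \<open>\<nabla>f x\<^sub>k\<close>
  (\<open>mean_gap_decrease\<close>). Conversely, averaging contracts \<open>e\<^sub>k\<close> by the factor \<open>1 - g\<close>, where \<open>g\<close> is
  the momentum coefficient, up to the drift of the gradient, which is of order \<open>L\<^sup>2 r\<^sub>k\<close>, and fresh
  noise \<open>g\<^sup>2 \<sigma>\<^sup>2\<close> (\<open>momentum_error_recursion\<close>). The fresh noise enters only through its variance
  since the new sample is independent of the past.

  Put \<open>N = M - L\<close>. With \<open>g\<close> proportional to \<open>L / N\<close>, the two effects cancel in the potential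
  \<open>E F x\<^sub>k - F\<^sup>\<star> + sqrt (19/156) e\<^sub>k / L\<close>: it decreases in each iteration by a multiple of
  \<open>N r\<^sub>k + e\<^sub>k / N\<close>, up to noise of order \<open>L \<sigma>\<^sup>2 / N\<^sup>2\<close> (\<open>potential_telescoping\<close>). On the other hand,
  approximate stationarity of the model gives
  \<open>E \<parallel>\<nabla>F x\<^sub>k\<^sub>+\<^sub>1\<parallel>\<^sup>2 \<le> 4 S\<^sub>k + O (N\<^sup>2 r\<^sub>k + e\<^sub>k)\<close> (\<open>mean_sq_gradient_le\<close>), so that the mean over the
  iterations is at most
  \<open>(4 / K) \<Sum> S\<^sub>k + O (N \<Phi>\<^sub>0 / K + L \<sigma>\<^sup>2 / N)\<close>. The given \<open>M\<close> balances the last two terms, which become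
  of order \<open>L \<Phi>\<^sub>0 / K + sqrt (L \<Phi>\<^sub>0 \<sigma>\<^sup>2 / K)\<close>; this is at most \<open>\<epsilon> / 2\<close> once \<open>K\<close> is a large multiple of
  \<open>L \<Phi>\<^sub>0 \<sigma>\<^sup>2 / \<epsilon>\<^sup>2 + L \<Phi>\<^sub>0 / \<epsilon>\<close> (\<open>iteration_count_suffices\<close>). Finally, an independent uniform index
  turns the mean over the iterations into an expectation (\<open>mean_sq_uniform_index\<close>).

  All moments involved have to be shown finite first. This follows by induction along the run from
  the same inequalities, read pointwise or for integrals in \<open>[0, \<infinity>]\<close>.
\<close>

section \<open>Gradients and quadratic bounds\<close>

lemma DERIV_along_line:
  fixes f :: "'a::euclidean_space \<Rightarrow> real"
  assumes "f differentiable (at (x + t *\<^sub>R v))"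
  shows "((\<lambda>t. f (x + t *\<^sub>R v)) has_real_derivative gradient f (x + t *\<^sub>R v) \<bullet> v) (at t)"
proof -
  have "(f has_derivative (\<lambda>h. h \<bullet> gradient f (x + t *\<^sub>R v))) (at (x + t *\<^sub>R v))"
    using GDERIV_gradient[OF assms] by (simp add: gderiv_def)
  moreover have "((\<lambda>t::real. x + t *\<^sub>R v) has_derivative (\<lambda>t. t *\<^sub>R v)) (at t)"
    by (auto intro!: derivative_eq_intros)
  ultimately have "((\<lambda>t. f (x + t *\<^sub>R v)) has_derivative
      (\<lambda>s. (s *\<^sub>R v) \<bullet> gradient f (x + t *\<^sub>R v))) (at t)"
    using has_derivative_compose by fastforce
  moreover have "(\<lambda>s. (s *\<^sub>R v) \<bullet> gradient f (x + t *\<^sub>R v)) = (*) (gradient f (x + t *\<^sub>R v) \<bullet> v)"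
    by (auto simp: inner_commute)
  ultimately show ?thesis
    by (simp add: has_field_derivative_def)
qed

lemma inner_gradient_LIMSEQ:
  fixes f :: "'a::euclidean_space \<Rightarrow> real"
  assumes "f differentiable (at x)"
  shows "(\<lambda>n. (f (x + inverse (real (Suc n)) *\<^sub>R b) - f x) / inverse (real (Suc n)))
    \<longlonglongrightarrow> gradient f x \<bullet> b"
proof -
  have "((\<lambda>t. (f (x + t *\<^sub>R b) - f x) / t) \<longlongrightarrow> gradient f x \<bullet> b) (at 0)"
    using DERIV_along_line[of f x 0 b] assms by (simp add: DERIV_def)
  moreover have "filterlim (\<lambda>n. inverse (real (Suc n))) (at 0) sequentially"
    using LIMSEQ_inverse_real_of_nat by (simp add: filterlim_at)
  ultimately show ?thesis
    by (rule filterlim_compose)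
qed

text \<open>
  The gradient need not be continuous, but each of its coordinates is a pointwise limit of difference
  quotients. Measurability is what allows expectations in \<open>[0, \<infinity>]\<close> to be split into sums.
\<close>
lemma borel_measurable_gradient:
  fixes f :: "'a::euclidean_space \<Rightarrow> real"
  assumes "\<And>x. f differentiable (at x)"
  shows "gradient f \<in> borel_measurable borel"
proof (subst borel_measurable_euclidean_space, intro ballI)
  fix b :: 'a
  have "continuous_on UNIV f"
    using assms by (simp add: continuous_at_imp_continuous_on differentiable_imp_continuous_within)
  then have [measurable]: "f \<in> borel_measurable borel"
    by (rule borel_measurable_continuous_onI)
  show "(\<lambda>x. gradient f x \<bullet> b) \<in> borel_measurable borel"
    by (rule borel_measurable_LIMSEQ_real[OF inner_gradient_LIMSEQ[OF assms]]) measurable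
qed

text \<open>
  Along the segment from \<open>x\<close> to \<open>y\<close>, the difference \<open>h\<close> of the two sides has nonpositive derivative
  by the Cauchy-Schwarz inequality and the Lipschitz condition.
\<close>
lemma smooth_with_quadratic_upper_bound:
  fixes f :: "'a::euclidean_space \<Rightarrow> real"
  assumes diff: "\<And>x. f differentiable (at x)" and smooth: "smooth_with L f"
  shows "f y \<le> f x + gradient f x \<bullet> (y - x) + L / 2 * (norm (y - x))\<^sup>2"
proof -
  define v where "v = y - x"
  define h where "h t = f (x + t *\<^sub>R v) - t * (gradient f x \<bullet> v) - L / 2 * t\<^sup>2 * (norm v)\<^sup>2" for t
  have der: "(h has_real_derivative
      (gradient f (x + t *\<^sub>R v) - gradient f x) \<bullet> v - L * t * (norm v)\<^sup>2) (at t)" for t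
    unfolding h_def
    by (auto intro!: derivative_eq_intros DERIV_along_line[OF diff] simp: inner_diff_left)
  have "h 1 \<le> h 0"
  proof (rule DERIV_nonpos_imp_nonincreasing[where f = h])
    fix t :: real
    assume t: "0 \<le> t" "t \<le> 1"
    have "(gradient f (x + t *\<^sub>R v) - gradient f x) \<bullet> v
        \<le> norm (gradient f (x + t *\<^sub>R v) - gradient f x) * norm v"
      by (rule norm_cauchy_schwarz)
    also have "\<dots> \<le> (L * norm (t *\<^sub>R v)) * norm v"
      using smooth unfolding smooth_with_def
      by (intro mult_right_mono) (auto dest: spec2[of _ "x + t *\<^sub>R v" x])
    also have "\<dots> = L * t * (norm v)\<^sup>2"
      using t by (simp add: power2_eq_square)
    finally show "\<exists>d. (h has_real_derivative d) (at t) \<and> d \<le> 0"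
      using der[of t] by fastforce
  qed simp
  then show ?thesis
    by (simp add: h_def v_def)
qed

lemma gradient_add:
  assumes "f differentiable (at x)" "\<psi> differentiable (at x)"
  shows "gradient (\<lambda>y. f y + \<psi> y) x = gradient f x + gradient \<psi> x"
  by (intro gradient_eqI GDERIV_add GDERIV_gradient assms)

lemma gradient_prox_model:
  assumes "\<psi> differentiable (at x)"
  shows "gradient (prox_model \<psi> M m y) x = m + gradient \<psi> x + M *\<^sub>R (x - y)"
proof (rule gradient_eqI)
  have "((\<lambda>x. m \<bullet> x + \<psi> x + M / 2 * ((x - y) \<bullet> (x - y))) has_derivative
     (\<lambda>h. m \<bullet> h + h \<bullet> gradient \<psi> x + M / 2 * ((x - y) \<bullet> h + h \<bullet> (x - y)))) (at x)"
    using GDERIV_gradient[OF assms] unfolding gderiv_def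
    by (auto intro!: derivative_eq_intros)
  then show "GDERIV (prox_model \<psi> M m y) x :> m + gradient \<psi> x + M *\<^sub>R (x - y)"
    unfolding gderiv_def prox_model_def power2_norm_eq_inner
    by (rule has_derivative_eq_rhs)
       (auto simp: inner_commute inner_add_right inner_diff_right inner_diff_left algebra_simps)
qed

text \<open>
  The defect is \<open>\<parallel>(1 - \<theta>) u - \<theta> v\<parallel>\<^sup>2 / (\<theta> (1 - \<theta>))\<close>. The weight \<open>\<theta> = 1 - g\<close> makes the old momentum
  error contract by exactly \<open>1 - g\<close>.
\<close>
lemma norm_add_sq_le_weighted:
  fixes u v :: "'a::real_inner"
  assumes "0 < \<theta>" "\<theta> < 1"
  shows "(norm (u + v))\<^sup>2 \<le> (norm u)\<^sup>2 / \<theta> + (norm v)\<^sup>2 / (1 - \<theta>)"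
proof -
  have "0 \<le> (norm ((1 - \<theta>) *\<^sub>R u - \<theta> *\<^sub>R v))\<^sup>2 / (\<theta> * (1 - \<theta>))"
    using assms by simp
  also have "\<dots> = (norm u)\<^sup>2 / \<theta> + (norm v)\<^sup>2 / (1 - \<theta>) - (norm (u + v))\<^sup>2"
    using assms unfolding power2_norm_eq_inner
    by (simp add: inner_commute inner_add_right inner_add_left inner_diff_right inner_diff_left divide_simps) (simp add: algebra_simps power2_eq_square)
  finally show ?thesis by simp
qed

section \<open>Independence\<close>
lemma independent_rv_distr_pair:
  assumes "prob_space P" and "independent_rv P S X T Y"
  shows "distr P (S \<Otimes>\<^sub>M T) (\<lambda>\<omega>. (X \<omega>, Y \<omega>)) = distr P S X \<Otimes>\<^sub>M distr P T Y"
proof -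
  interpret P: prob_space P by fact
  have X [measurable]: "X \<in> measurable P S" and Y [measurable]: "Y \<in> measurable P T"
    and ind: "P.indep_set {X -` A \<inter> space P | A. A \<in> sets S} {Y -` B \<inter> space P | B. B \<in> sets T}"
    using assms(2) by (auto simp: independent_rv_def)
  interpret X: prob_space "distr P S X" by (rule P.prob_space_distr) fact
  interpret Y: prob_space "distr P T Y" by (rule P.prob_space_distr) fact
  show ?thesis
  proof (rule pair_measure_eqI[symmetric])
    fix A B
    assume "A \<in> sets (distr P S X)" "B \<in> sets (distr P T Y)"
    then have A [measurable]: "A \<in> sets S" and B [measurable]: "B \<in> sets T" by auto
    have "(\<lambda>\<omega>. (X \<omega>, Y \<omega>)) -` (A \<times> B) \<inter> space P = (X -` A \<inter> space P) \<inter> (Y -` B \<inter> space P)"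
      by auto
    moreover have "P.prob ((X -` A \<inter> space P) \<inter> (Y -` B \<inter> space P)) =
        P.prob (X -` A \<inter> space P) * P.prob (Y -` B \<inter> space P)"
      using A B by (intro P.indep_setD[OF ind]) auto
    ultimately show "emeasure (distr P S X) A * emeasure (distr P T Y) B =
        emeasure (distr P (S \<Otimes>\<^sub>M T) (\<lambda>\<omega>. (X \<omega>, Y \<omega>))) (A \<times> B)"
      by (simp add: emeasure_distr P.emeasure_eq_measure ennreal_mult)
  qed (simp_all add: X.sigma_finite_measure Y.sigma_finite_measure cong: sets_pair_measure_cong)
qed

text \<open>
  Fubini for independent variables. It replaces conditional expectations throughout: the past
  \<open>Y \<omega>\<close> is held fixed while the fresh variable \<open>X\<close> is integrated out.
\<close>
lemma independent_rv_nn_integral: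
  assumes "prob_space P" and ind: "independent_rv P S X T Y"
    and h [measurable]: "h \<in> borel_measurable (S \<Otimes>\<^sub>M T)"
  shows "(\<integral>\<^sup>+\<omega>. h (X \<omega>, Y \<omega>) \<partial>P) = (\<integral>\<^sup>+\<omega>. \<integral>\<^sup>+s. h (s, Y \<omega>) \<partial>distr P S X \<partial>P)"
proof -
  interpret P: prob_space P by fact
  have X [measurable]: "X \<in> measurable P S" and Y [measurable]: "Y \<in> measurable P T"
    using ind by (auto simp: independent_rv_def)
  interpret X: prob_space "distr P S X" by (rule P.prob_space_distr) fact
  interpret Y: prob_space "distr P T Y" by (rule P.prob_space_distr) fact
  interpret XY: pair_sigma_finite "distr P S X" "distr P T Y" ..
  have h': "h \<in> borel_measurable (distr P S X \<Otimes>\<^sub>M distr P T Y)"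
    by simp
  have "(\<integral>\<^sup>+\<omega>. h (X \<omega>, Y \<omega>) \<partial>P) = (\<integral>\<^sup>+z. h z \<partial>distr P (S \<Otimes>\<^sub>M T) (\<lambda>\<omega>. (X \<omega>, Y \<omega>)))"
    by (simp add: nn_integral_distr)
  also have "\<dots> = (\<integral>\<^sup>+y. \<integral>\<^sup>+s. h (s, y) \<partial>distr P S X \<partial>distr P T Y)"
    unfolding independent_rv_distr_pair[OF assms(1) ind] by (rule XY.nn_integral_snd[OF h', symmetric])
  also have "\<dots> = (\<integral>\<^sup>+\<omega>. \<integral>\<^sup>+s. h (s, Y \<omega>) \<partial>distr P S X \<partial>P)"
    by (rule nn_integral_distr[OF Y], rule X.borel_measurable_nn_integral) simp
  finally show ?thesis .
qed

text \<open>
  The cross term vanishes because \<open>Z - \<mu>\<close> has mean zero; finite variance makes the expanded square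
  integrable.
\<close>
lemma mean_sq_add_centered_le:
  fixes Z :: "'s \<Rightarrow> 'a::euclidean_space"
  assumes "prob_space D" and Z: "has_bochner_integral D Z \<mu>"
    and var: "mean_sq D (\<lambda>s. Z s - \<mu>) \<le> ennreal v" and "0 \<le> v"
  shows "mean_sq D (\<lambda>s. c + \<gamma> *\<^sub>R (Z s - \<mu>)) \<le> ennreal ((norm c)\<^sup>2 + \<gamma>\<^sup>2 * v)"
proof -
  interpret prob_space D by fact
  have intZ: "integrable D Z" and EZ: "integral\<^sup>L D Z = \<mu>"
    using Z by (auto simp: has_bochner_integral_iff)
  have [measurable]: "Z \<in> borel_measurable D" using intZ by auto
  have sq: "integrable D (\<lambda>s. (norm (Z s - \<mu>))\<^sup>2)"
    using var unfolding mean_sq_def by (intro integrableI_bounded) (auto intro: le_less_trans)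
  have "(\<integral>s. (norm (Z s - \<mu>))\<^sup>2 \<partial>D) \<le> v"
    using var sq \<open>0 \<le> v\<close> unfolding mean_sq_def by (simp add: nn_integral_eq_integral)
  moreover have "mean_sq D (\<lambda>s. c + \<gamma> *\<^sub>R (Z s - \<mu>)) =
      ennreal (\<integral>s. (norm c)\<^sup>2 + 2 * \<gamma> * (c \<bullet> (Z s - \<mu>)) + \<gamma>\<^sup>2 * (norm (Z s - \<mu>))\<^sup>2 \<partial>D)"
  proof -
    have eq: "(norm (c + \<gamma> *\<^sub>R z))\<^sup>2 = (norm c)\<^sup>2 + 2 * \<gamma> * (c \<bullet> z) + \<gamma>\<^sup>2 * (norm z)\<^sup>2" for z :: 'a
      unfolding power2_norm_eq_inner
      by (simp add: inner_add_left inner_add_right inner_commute power2_eq_square)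
    have "integrable D (\<lambda>s. (norm c)\<^sup>2 + 2 * \<gamma> * (c \<bullet> (Z s - \<mu>)) + \<gamma>\<^sup>2 * (norm (Z s - \<mu>))\<^sup>2)"
      using intZ sq by (intro Bochner_Integration.integrable_add integrable_mult_right) auto
    then show ?thesis
      unfolding mean_sq_def eq by (intro nn_integral_eq_integral AE_I2) (auto simp: eq[symmetric])
  qed
  moreover have "(\<integral>s. (norm c)\<^sup>2 + 2 * \<gamma> * (c \<bullet> (Z s - \<mu>)) + \<gamma>\<^sup>2 * (norm (Z s - \<mu>))\<^sup>2 \<partial>D) =
      (norm c)\<^sup>2 + \<gamma>\<^sup>2 * (\<integral>s. (norm (Z s - \<mu>))\<^sup>2 \<partial>D)"
    using intZ sq EZ by (simp add: prob_space inner_diff_right)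
  ultimately show ?thesis
    by (simp add: ennreal_leI mult_left_mono del: ennreal_plus)
qed

text \<open>
  The index is the fresh variable and the whole run is the past, so integrating out the index gives
  the arithmetic mean.
\<close>
lemma mean_sq_uniform_index:
  fixes \<phi> :: "'a::euclidean_space \<Rightarrow> 'a"
  assumes "prob_space P" and t: "uniform_independent_index P D K x m_init m \<xi> t"
    and "1 \<le> K" and \<phi> [measurable]: "\<phi> \<in> borel_measurable borel"
  shows "mean_sq P (\<lambda>\<omega>. \<phi> (x (t \<omega>) \<omega>)) = (\<Sum>k<K. mean_sq P (\<lambda>\<omega>. \<phi> (x (Suc k) \<omega>))) / of_nat K"
proof -
  let ?H = "history_space {..K} {..<K} \<Otimes>\<^sub>M PiM {..<K} (\<lambda>_. D) ::
    (((nat \<Rightarrow> 'a) \<times> 'a \<times> (nat \<Rightarrow> 'a)) \<times> (nat \<Rightarrow> 'c)) measure"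
  let ?Y = "\<lambda>\<omega>. (history {..K} {..<K} x m_init m \<omega>, \<lambda>k\<in>{..<K}. \<xi> k \<omega>)"
  \<comment> \<open>Cutting off outside \<open>{1..K}\<close> matters for measurability: the history records \<open>x\<^sub>n\<close> only for \<open>n \<le> K\<close>.\<close>
  define h :: "nat \<times> ((nat \<Rightarrow> 'a) \<times> 'a \<times> (nat \<Rightarrow> 'a)) \<times> (nat \<Rightarrow> 'c) \<Rightarrow> ennreal" where
    "h = (\<lambda>(n, (y, _), _). if n \<in> {1..K} then ennreal ((norm (\<phi> (y n)))\<^sup>2) else 0)"
  have meas_t [measurable]: "t \<in> measurable P (count_space UNIV)"
    and distr_t: "distr P (count_space UNIV) t = measure_pmf (pmf_of_set {1..K})"
    and ind: "independent_rv P (count_space UNIV) t ?H ?Y"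
    using t by (auto simp: uniform_independent_index_def)
  have Y: "?Y \<in> measurable P ?H" using ind by (simp add: independent_rv_def)
  have comp [measurable]: "(\<lambda>z. fst (fst z) n) \<in> borel_measurable ?H" if "n \<le> K" for n
  proof -
    have [measurable]: "(\<lambda>y. y n) \<in> borel_measurable (PiM {..K} (\<lambda>_. borel))"
      using that by (intro measurable_component_singleton) simp
    show ?thesis unfolding history_space_def by measurable
  qed
  have h: "h \<in> borel_measurable (count_space UNIV \<Otimes>\<^sub>M ?H)"
  proof (rule measurable_pair_measure_countable1)
    fix n :: nat
    show "(\<lambda>z. h (n, z)) \<in> borel_measurable ?H"
    proof (cases "n \<in> {1..K}")
      case True
      then have "(\<lambda>z. h (n, z)) = (\<lambda>z. ennreal ((norm (\<phi> (fst (fst z) n)))\<^sup>2))"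
        by (auto simp: h_def split: prod.splits)
      then show ?thesis using comp[of n] True by simp
    next
      case False
      then have "(\<lambda>z. h (n, z)) = (\<lambda>z. 0)"
        by (auto simp: h_def split: prod.splits)
      then show ?thesis by simp
    qed
  qed simp
  have x_meas [measurable]: "x n \<in> borel_measurable P" if "n \<le> K" for n
    using measurable_compose[OF Y comp[OF that]] that by (simp add: history_def)
  have "AE \<omega> in P. t \<omega> \<in> {1..K}"
  proof (rule AE_distrD[OF meas_t])
    show "AE n in distr P (count_space UNIV) t. n \<in> {1..K}"
      unfolding distr_t using AE_measure_pmf[of "pmf_of_set {1..K}"] \<open>1 \<le> K\<close> by simp
  qed
  then have "mean_sq P (\<lambda>\<omega>. \<phi> (x (t \<omega>) \<omega>)) = (\<integral>\<^sup>+\<omega>. h (t \<omega>, ?Y \<omega>) \<partial>P)"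
    unfolding mean_sq_def by (intro nn_integral_cong_AE) (auto simp: h_def history_def)
  also have "\<dots> = (\<integral>\<^sup>+\<omega>. \<integral>\<^sup>+n. h (n, ?Y \<omega>) \<partial>measure_pmf (pmf_of_set {1..K}) \<partial>P)"
    using independent_rv_nn_integral[OF \<open>prob_space P\<close> ind h] by (simp add: distr_t)
  also have "\<dots> = (\<integral>\<^sup>+\<omega>. (\<Sum>k\<in>{1..K}. ennreal ((norm (\<phi> (x k \<omega>)))\<^sup>2)) / of_nat K \<partial>P)"
    using \<open>1 \<le> K\<close> by (subst nn_integral_pmf_of_set) (auto simp: h_def history_def intro!: nn_integral_cong)
  also have "\<dots> = (\<Sum>k\<in>{1..K}. mean_sq P (\<lambda>\<omega>. \<phi> (x k \<omega>))) / of_nat K"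
    unfolding mean_sq_def by (subst nn_integral_divide, simp, subst nn_integral_sum) auto
  also have "(\<Sum>k\<in>{1..K}. mean_sq P (\<lambda>\<omega>. \<phi> (x k \<omega>))) = (\<Sum>k<K. mean_sq P (\<lambda>\<omega>. \<phi> (x (Suc k) \<omega>)))"
    by (rule sum.reindex_bij_witness[of _ Suc "\<lambda>k. k - 1"]) auto
  finally show ?thesis .
qed

section \<open>The potential and the number of iterations\<close>

text \<open>
  The potential adds \<open>w = sqrt (19/156)\<close> times \<open>err / L\<close> to the gap. Write \<open>g = c L / N\<close>. Contraction of
  \<open>err\<close> gains \<open>w c err / N\<close> with \<open>w c > 31/30\<close>, which exceeds the loss \<open>5/6 err / N\<close> in \<open>gap\<close> by
  \<open>1/5 err / N\<close>. The drift costs at most \<open>(w / c) N step \<le> 3/25 N step\<close>, which leaves \<open>2/25 N step\<close> of the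
  gain \<open>1/5 N step\<close>. The noise contributes \<open>w c\<^sup>2 L \<sigma>\<^sup>2 / N\<^sup>2\<close> with \<open>w c\<^sup>2 < 16/5\<close>.
\<close>
lemma potential_telescoping:
  fixes gap err step :: "nat \<Rightarrow> real" and L N g \<sigma> :: real
  assumes L: "0 < L" and N: "3 * L \<le> N" and g: "g = sqrt (152 / 17) * L / N"
    and nonneg: "\<And>k. 0 \<le> gap k" "\<And>k. 0 \<le> err k" "\<And>k. 0 \<le> step k"
    and gap: "\<And>k. k < K \<Longrightarrow> gap (Suc k) + N / 5 * step k \<le> gap k + 5 / 6 * err k / N"
    and err: "\<And>k. Suc k < K \<Longrightarrow>
      err (Suc k) \<le> (1 - g) * err k + (1 - g)\<^sup>2 / g * L\<^sup>2 * step k + g\<^sup>2 * \<sigma>\<^sup>2"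
  shows "(\<Sum>k<K. 2 / 25 * N * step k + err k / (5 * N)) \<le>
    gap 0 + sqrt (19 / 156) * err 0 / L + real K * (16 / 5 * L * \<sigma>\<^sup>2 / N\<^sup>2)"
proof -
  define c w where "c = sqrt (152 / 17 :: real)" and "w = sqrt (19 / 156 :: real)"
  have N_pos: "0 < N" using L N by linarith
  have c: "0 < c" "c < 3"
    unfolding c_def by (auto intro!: real_less_rsqrt real_less_lsqrt simp: power2_eq_square)
  have wc: "w * c = sqrt (722 / 663)"
    unfolding c_def w_def by (simp flip: real_sqrt_mult)
  have wc_bounds: "31 / 30 < w * c" "w * c < 21 / 20"
  proof -
    show "31 / 30 < w * c"
      unfolding wc by (rule real_less_rsqrt) (simp add: power2_eq_square)
    show "w * c < 21 / 20"
      unfolding wc by (rule real_less_lsqrt) (simp_all add: power2_eq_square)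
  qed
  have w: "0 < w" by (simp add: w_def)
  have w_le: "w \<le> 3 / 25 * c"
  proof -
    have "w = sqrt (323 / 23712) * c"
      unfolding c_def w_def by (simp flip: real_sqrt_mult)
    moreover have "sqrt (323 / 23712) \<le> (3 / 25 :: real)"
      by (intro real_le_lsqrt) (auto simp: power2_eq_square)
    ultimately show ?thesis using c by (simp add: mult_right_mono)
  qed
  have g': "g = c * L / N" by (simp add: g c_def)
  have g_pos: "0 < g" using c L N_pos by (simp add: g')
  have g_less: "g < 1"
  proof -
    have "c * L < 3 * L" using c L by simp
    then show ?thesis using N N_pos by (simp add: g')
  qed
  \<comment> \<open>The last iterate is not followed by another momentum, so its potential is the gap alone.\<close>
  define \<Phi> where "\<Phi> k = gap k + (if k < K then w * err k / L else 0)" for k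
  have decrease: "\<Phi> (Suc k) + (2 / 25 * N * step k + err k / (5 * N)) \<le> \<Phi> k + 16 / 5 * L * \<sigma>\<^sup>2 / N\<^sup>2"
    if "k < K" for k
  proof -
    have "(if Suc k < K then err (Suc k) else 0)
        \<le> (1 - g) * err k + (1 - g)\<^sup>2 / g * L\<^sup>2 * step k + g\<^sup>2 * \<sigma>\<^sup>2"
      using err[of k] nonneg g_pos g_less by simp
    then have "w / L * (if Suc k < K then err (Suc k) else 0)
        \<le> w / L * ((1 - g) * err k + (1 - g)\<^sup>2 / g * L\<^sup>2 * step k + g\<^sup>2 * \<sigma>\<^sup>2)"
      using w L by (intro mult_left_mono) auto
    also have "\<dots> = w * err k / L - w * c * (err k / N) + (w / c) * (1 - g)\<^sup>2 * (N * step k)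
        + w * c * c * (L * \<sigma>\<^sup>2 / N\<^sup>2)"
      using L N_pos c by (simp add: g' field_simps power2_eq_square)
    also have "(w / c) * (1 - g)\<^sup>2 * (N * step k) \<le> 3 / 25 * (N * step k)"
    proof (intro mult_right_mono)
      have "(w / c) * (1 - g)\<^sup>2 \<le> (3 / 25) * 1"
        using w w_le c g_pos g_less by (intro mult_mono power_le_one) (auto simp: field_simps)
      then show "(w / c) * (1 - g)\<^sup>2 \<le> 3 / 25" by simp
    qed (use N_pos nonneg in simp)
    also have "w * c * c * (L * \<sigma>\<^sup>2 / N\<^sup>2) \<le> 16 / 5 * (L * \<sigma>\<^sup>2 / N\<^sup>2)"
    proof (intro mult_right_mono)
      have "w * c * c \<le> 21 / 20 * 3" using wc_bounds c w by (intro mult_mono) auto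
      then show "w * c * c \<le> 16 / 5" by simp
    qed (use L in simp)
    finally have "w / L * (if Suc k < K then err (Suc k) else 0) \<le>
        w * err k / L - w * c * (err k / N) + 3 / 25 * (N * step k) + 16 / 5 * (L * \<sigma>\<^sup>2 / N\<^sup>2)"
      by simp
    moreover have "31 / 30 * (err k / N) \<le> w * c * (err k / N)"
      using wc_bounds nonneg N_pos by (intro mult_right_mono) auto
    moreover have "\<Phi> (Suc k) = gap (Suc k) + w / L * (if Suc k < K then err (Suc k) else 0)"
      "\<Phi> k = gap k + w * err k / L"
      using that by (auto simp: \<Phi>_def)
    ultimately show ?thesis
      using gap[OF that] by (simp add: field_simps)
  qed
  have "\<Phi> j + (\<Sum>k<j. 2 / 25 * N * step k + err k / (5 * N)) \<le> \<Phi> 0 + real j * (16 / 5 * L * \<sigma>\<^sup>2 / N\<^sup>2)"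
    if "j \<le> K" for j
    using that
  proof (induction j)
    case (Suc j)
    then have "\<Phi> j + (\<Sum>k<j. 2 / 25 * N * step k + err k / (5 * N))
        \<le> \<Phi> 0 + real j * (16 / 5 * L * \<sigma>\<^sup>2 / N\<^sup>2)"
      by simp
    moreover have "\<Phi> (Suc j) + (2 / 25 * N * step j + err j / (5 * N)) \<le> \<Phi> j + 16 / 5 * L * \<sigma>\<^sup>2 / N\<^sup>2"
      using Suc.prems by (intro decrease) simp
    ultimately show ?case
      unfolding sum.lessThan_Suc of_nat_Suc distrib_right mult_1_left by linarith
  qed simp
  from this[of K] have "\<Phi> K + (\<Sum>k<K. 2 / 25 * N * step k + err k / (5 * N))
      \<le> \<Phi> 0 + real K * (16 / 5 * L * \<sigma>\<^sup>2 / N\<^sup>2)"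
    by simp
  moreover have "0 \<le> \<Phi> K" using nonneg by (simp add: \<Phi>_def)
  moreover have "\<Phi> 0 \<le> gap 0 + sqrt (19 / 156) * err 0 / L"
    using nonneg L by (simp add: \<Phi>_def w_def)
  ultimately show ?thesis by linarith
qed

text \<open>
  Let \<open>q\<close> be the square root in \<open>N\<close>. Since \<open>L \<sigma>\<^sup>2 = q\<^sup>2 \<Phi> / (8 K)\<close> and \<open>q \<le> N\<close>, the noise term is at most
  \<open>30 q \<Phi> / K\<close>, also when \<open>q = 0\<close>. Thus only \<open>L \<Phi> / K\<close> and
  \<open>q \<Phi> / K = sqrt (8 L \<Phi> \<sigma>\<^sup>2 / K)\<close> have to be small compared with \<open>\<epsilon>\<close>, and each of the two summands in
  the lower bound for \<open>K\<close> takes care of one of them.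
\<close>
lemma iteration_count_suffices:
  fixes K :: nat and L \<Phi> \<sigma> \<epsilon> :: real
  assumes "0 < L" "0 < \<Phi>" "0 < \<epsilon>" "1 \<le> K"
    and K: "iteration_constant * (L * \<Phi> * \<sigma>\<^sup>2 / \<epsilon>\<^sup>2 + L * \<Phi> / \<epsilon>) \<le> real K"
    and N: "N = 3 * L + sqrt (8 * real K * L * \<sigma>\<^sup>2 / \<Phi>)"
  shows "75 * N / K * (\<Phi> + K * (16 / 5 * L * \<sigma>\<^sup>2 / N\<^sup>2)) \<le> \<epsilon> / 2"
proof -
  define q where "q = sqrt (8 * real K * L * \<sigma>\<^sup>2 / \<Phi>)"
  have K_pos: "0 < real K" using assms by simp
  have q: "0 \<le> q" "q\<^sup>2 * \<Phi> = 8 * real K * L * \<sigma>\<^sup>2" using assms by (auto simp: q_def)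
  have Nq: "N = 3 * L + q" by (simp add: N q_def)
  have N_pos: "0 < N" using assms(1) q Nq by linarith
  have "10 ^ 7 * (L * \<Phi> / \<epsilon>) \<le> K"
  proof -
    have "0 \<le> L * \<Phi> * \<sigma>\<^sup>2 / \<epsilon>\<^sup>2" using assms by simp
    then show ?thesis using K unfolding iteration_constant_def by (simp add: distrib_left)
  qed
  then have a: "L * \<Phi> / K \<le> \<epsilon> / 10000000"
    using assms K_pos by (simp add: field_simps)
  have "10 ^ 7 * (L * \<Phi> * \<sigma>\<^sup>2 / \<epsilon>\<^sup>2) \<le> K"
  proof -
    have "0 \<le> L * \<Phi> / \<epsilon>" using assms by simp
    then show ?thesis using K unfolding iteration_constant_def by (simp add: distrib_left)
  qed
  then have b: "L * \<Phi> * \<sigma>\<^sup>2 / K \<le> \<epsilon>\<^sup>2 / 10000000"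
    using assms K_pos by (simp add: field_simps)
  have "(q * \<Phi> / K)\<^sup>2 = 8 * (L * \<Phi> * \<sigma>\<^sup>2 / K)"
  proof -
    have "(q * \<Phi> / K)\<^sup>2 = (q\<^sup>2 * \<Phi>) * \<Phi> / (real K)\<^sup>2"
      by (simp add: power2_eq_square)
    then show ?thesis
      unfolding q(2) using K_pos by (simp add: power2_eq_square)
  qed
  also have "\<dots> \<le> (\<epsilon> / 1000)\<^sup>2"
  proof -
    have "(\<epsilon> / 1000)\<^sup>2 = \<epsilon>\<^sup>2 / 1000000" by (simp add: power_divide)
    then show ?thesis using b zero_le_power2[of \<epsilon>] by linarith
  qed
  finally have c: "q * \<Phi> / K \<le> \<epsilon> / 1000"
    by (rule power2_le_imp_le) (use assms in simp)
  have "75 * N / K * (\<Phi> + K * (16 / 5 * L * \<sigma>\<^sup>2 / N\<^sup>2)) = 75 * N * \<Phi> / K + 240 * (L * \<sigma>\<^sup>2) / N"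
    using N_pos K_pos by (simp add: field_simps power2_eq_square)
  also have "L * \<sigma>\<^sup>2 = q\<^sup>2 * \<Phi> / (8 * K)"
    using K_pos unfolding q(2) by simp
  also have "240 * (q\<^sup>2 * \<Phi> / (8 * K)) / N = 30 * (q * \<Phi> / K) * (q / N)"
    by (simp add: power2_eq_square)
  also have "75 * N * \<Phi> / K = 225 * (L * \<Phi> / K) + 75 * (q * \<Phi> / K)"
    by (simp add: Nq add_divide_distrib algebra_simps)
  finally have "75 * N / K * (\<Phi> + K * (16 / 5 * L * \<sigma>\<^sup>2 / N\<^sup>2)) =
      225 * (L * \<Phi> / K) + 75 * (q * \<Phi> / K) + 30 * (q * \<Phi> / K) * (q / N)" .
  moreover have "30 * (q * \<Phi> / K) * (q / N) \<le> 30 * (q * \<Phi> / K) * 1"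
    using q Nq N_pos assms by (intro mult_left_mono) auto
  moreover have "225 * A + 75 * B + C \<le> \<epsilon> / 2"
    if "A \<le> \<epsilon> / 10000000" "B \<le> \<epsilon> / 1000" "C \<le> 30 * B * 1" for A B C :: real
    using that \<open>0 < \<epsilon>\<close> by linarith
  ultimately show ?thesis
    using a c by presburger
qed

section \<open>One run of the method\<close>
text \<open>
  The coefficients \<open>M > L\<close> and \<open>g \<in> (0, 1)\<close> stay free here: the inequalities for a single iteration
  hold for all of them, and the specific values are needed only to balance the inequalities.
\<close>

locale prox_momentum_run = prob_space P
  for P :: "'w measure" +
  fixes D :: "'s measure" and G :: "'a::euclidean_space \<Rightarrow> 's \<Rightarrow> 'a" and f \<psi> :: "'a \<Rightarrow> real"
    and L \<sigma> Fstar M :: real and K :: nat and g_init g :: real and \<gamma> :: "nat \<Rightarrow> real"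
    and x0 :: 'a and m_init :: "'w \<Rightarrow> 'a" and \<xi> :: "nat \<Rightarrow> 'w \<Rightarrow> 's" and x :: "nat \<Rightarrow> 'w \<Rightarrow> 'a"
    and m :: "nat \<Rightarrow> 'w \<Rightarrow> 'a"
  assumes L_pos: "0 < L" and L_less_M: "L < M" and g_pos: "0 < g" and g_less_1: "g < 1"
    and f_diff: "\<And>y. f differentiable (at y)" and \<psi>_diff: "\<And>y. \<psi> differentiable (at y)"
    and Fstar_le: "\<And>y. Fstar \<le> f y + \<psi> y"
    and smooth: "smooth_with L f"
    and unbiased: "unbiased_oracle D G f \<sigma>"
    and \<gamma>_eq: "\<And>k. k < K \<Longrightarrow> \<gamma> k = g"
    and m_eq: "m = momentum G g_init \<gamma> m_init \<xi> x"
    and run: "momentum_run P D G K g_init \<gamma> x0 m_init \<xi> x"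
    and initial_error: "integrable P (\<lambda>\<omega>. (norm (m 0 \<omega> - gradient f x0))\<^sup>2)"
    and model_decrease: "\<And>k. k < K \<Longrightarrow> AE \<omega> in P.
        prox_model \<psi> M (m k \<omega>) (x k \<omega>) (x (Suc k) \<omega>) \<le> prox_model \<psi> M (m k \<omega>) (x k \<omega>) (x k \<omega>)"
begin

abbreviation gap :: "nat \<Rightarrow> 'w \<Rightarrow> real"
  where "gap k \<omega> \<equiv> f (x k \<omega>) + \<psi> (x k \<omega>) - Fstar"

abbreviation err :: "nat \<Rightarrow> 'w \<Rightarrow> real"
  where "err k \<omega> \<equiv> (norm (m k \<omega> - gradient f (x k \<omega>)))\<^sup>2"

abbreviation step :: "nat \<Rightarrow> 'w \<Rightarrow> real"
  where "step k \<omega> \<equiv> (norm (x (Suc k) \<omega> - x k \<omega>))\<^sup>2"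

lemma gap_nonneg: "0 \<le> gap k \<omega>"
  using Fstar_le[of "x k \<omega>"] by simp

lemma measurable_objective [measurable]:
  "f \<in> borel_measurable borel" "\<psi> \<in> borel_measurable borel"
  "gradient f \<in> borel_measurable borel" "gradient \<psi> \<in> borel_measurable borel"
proof -
  have "continuous_on UNIV f" "continuous_on UNIV \<psi>"
    using f_diff \<psi>_diff by (auto intro!: continuous_at_imp_continuous_on differentiable_imp_continuous_within)
  then show "f \<in> borel_measurable borel" "\<psi> \<in> borel_measurable borel"
    by (auto intro: borel_measurable_continuous_onI)
qed (simp_all add: borel_measurable_gradient f_diff \<psi>_diff)

lemma measurable_G: "case_prod G \<in> borel_measurable (borel \<Otimes>\<^sub>M D)"
  using unbiased by (simp add: unbiased_oracle_def)

lemma measurable_G_compose [measurable (raw)]: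
  assumes "X \<in> borel_measurable N" "Y \<in> measurable N D"
  shows "(\<lambda>\<omega>. G (X \<omega>) (Y \<omega>)) \<in> borel_measurable N"
  using measurable_compose[OF measurable_Pair[OF assms] measurable_G] by simp

lemma measurable_x [measurable]: "k \<le> K \<Longrightarrow> x k \<in> borel_measurable P"
  using run by (simp add: momentum_run_def)

lemma measurable_\<xi> [measurable]: "k < K \<Longrightarrow> \<xi> k \<in> measurable P D"
  using run by (simp add: momentum_run_def)

lemma measurable_m [measurable]: "k < K \<Longrightarrow> m k \<in> borel_measurable P"
proof (induction k)
  case 0
  then have [measurable]: "x 0 \<in> borel_measurable P" "\<xi> 0 \<in> measurable P D" "m_init \<in> borel_measurable P"
    using run by (auto simp: momentum_run_def)
  show ?case unfolding m_eq momentum.simps by measurable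
next
  case (Suc k)
  then have [measurable]: "x (Suc k) \<in> borel_measurable P" "\<xi> (Suc k) \<in> measurable P D" "m k \<in> borel_measurable P"
    by auto
  show ?case unfolding m_eq momentum.simps unfolding m_eq[symmetric] by measurable
qed

text \<open>
  Smoothness bounds \<open>f x\<^sub>k\<^sub>+\<^sub>1\<close> from above and decrease of the model bounds \<open>\<psi> x\<^sub>k\<^sub>+\<^sub>1\<close>. In the sum,
  the linear terms combine to \<open>(\<nabla>f x\<^sub>k - m\<^sub>k) \<bullet> (x\<^sub>k\<^sub>+\<^sub>1 - x\<^sub>k)\<close>, and Young's inequality splits this product.
  The parameter \<open>b\<close> is the share of the quadratic term that is given up.
\<close>
lemma gap_decrease:
  assumes "k < K" "0 < b"
  shows "AE \<omega> in P. gap (Suc k) \<omega> + (M - L - b) / 2 * step k \<omega> \<le> gap k \<omega> + err k \<omega> / (2 * b)"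
  using model_decrease[OF \<open>k < K\<close>]
proof eventually_elim
  case (elim \<omega>)
  define u v where "u = gradient f (x k \<omega>) - m k \<omega>" and "v = x (Suc k) \<omega> - x k \<omega>"
  have "u \<bullet> v \<le> (norm u)\<^sup>2 / (2 * b) + b / 2 * (norm v)\<^sup>2"
  proof -
    have "0 \<le> (norm (u - b *\<^sub>R v))\<^sup>2 / (2 * b)" using assms by simp
    also have "\<dots> = (norm u)\<^sup>2 / (2 * b) + b / 2 * (norm v)\<^sup>2 - u \<bullet> v"
      using assms unfolding power2_norm_eq_inner
      by (simp add: inner_diff_left inner_diff_right inner_commute field_simps)
    finally show ?thesis by simp
  qed
  moreover have "f (x (Suc k) \<omega>) \<le> f (x k \<omega>) + gradient f (x k \<omega>) \<bullet> v + L / 2 * (norm v)\<^sup>2"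
    unfolding v_def by (rule smooth_with_quadratic_upper_bound[OF f_diff smooth])
  moreover have "m k \<omega> \<bullet> v + \<psi> (x (Suc k) \<omega>) + M / 2 * (norm v)\<^sup>2 \<le> \<psi> (x k \<omega>)"
    using elim by (simp add: prox_model_def v_def inner_diff_right)
  moreover have "norm u = norm (m k \<omega> - gradient f (x k \<omega>))"
    by (simp add: u_def norm_minus_commute)
  ultimately show ?case
    by (simp add: u_def v_def inner_diff_left field_simps)
qed

text \<open>
  Both quantities are nonnegative and occur on the left of the pointwise decrease, so the right-hand
  side dominates them as long as \<open>b < M - L\<close>.
\<close>
lemma integrable_gap_step:
  assumes "k < K" and gap: "integrable P (gap k)" and err: "integrable P (err k)"
  shows "integrable P (gap (Suc k))" "integrable P (step k)"
proof -
  define b where "b = (M - L) / 2"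
  have b: "0 < b" using L_less_M by (simp add: b_def)
  have [measurable]: "x k \<in> borel_measurable P" "x (Suc k) \<in> borel_measurable P"
    using \<open>k < K\<close> by auto
  have b': "M - L - b = b" by (simp add: b_def field_simps)
  note decrease = gap_decrease[OF \<open>k < K\<close> b, unfolded b']
  have int: "integrable P (\<lambda>\<omega>. gap k \<omega> + err k \<omega> / (2 * b))"
    using gap err by simp
  show "integrable P (gap (Suc k))"
  proof (rule Bochner_Integration.integrable_bound[OF int])
    show "AE \<omega> in P. norm (gap (Suc k) \<omega>) \<le> norm (gap k \<omega> + err k \<omega> / (2 * b))"
      using decrease
    proof eventually_elim
      case (elim \<omega>)
      moreover have "0 \<le> b / 2 * step k \<omega>" using b by simp
      ultimately show ?case
        using gap_nonneg[of "Suc k" \<omega>] unfolding real_norm_def by linarith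
    qed
  qed measurable
  have int2: "integrable P (\<lambda>\<omega>. 2 / b * (gap k \<omega> + err k \<omega> / (2 * b)))"
    using int by (rule integrable_mult_right)
  show "integrable P (step k)"
  proof (rule Bochner_Integration.integrable_bound[OF int2])
    show "AE \<omega> in P. norm (step k \<omega>) \<le> norm (2 / b * (gap k \<omega> + err k \<omega> / (2 * b)))"
      using decrease
    proof eventually_elim
      case (elim \<omega>)
      have "b / 2 * step k \<omega> \<le> gap k \<omega> + err k \<omega> / (2 * b)"
        using elim gap_nonneg[of "Suc k" \<omega>] by linarith
      then have "step k \<omega> \<le> 2 / b * (gap k \<omega> + err k \<omega> / (2 * b))"
        using b by (simp add: field_simps)
      moreover have "0 \<le> step k \<omega>" by simp
      ultimately show ?case unfolding real_norm_def by linarith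
    qed
  qed measurable
qed

lemma mean_gap_decrease:
  assumes "k < K" "0 < b" and "integrable P (gap k)" "integrable P (err k)"
  shows "expectation (gap (Suc k)) + (M - L - b) / 2 * expectation (step k)
    \<le> expectation (gap k) + expectation (err k) / (2 * b)"
proof -
  note int = integrable_gap_step[OF assms(1,3,4)] assms(3,4)
  have "expectation (\<lambda>\<omega>. gap (Suc k) \<omega> + (M - L - b) / 2 * step k \<omega>) \<le>
      expectation (\<lambda>\<omega>. gap k \<omega> + err k \<omega> / (2 * b))"
    by (rule integral_mono_AE[OF _ _ gap_decrease[OF assms(1,2)]])
       (intro Bochner_Integration.integrable_add integrable_mult_right integrable_divide int)+
  also have "expectation (\<lambda>\<omega>. gap (Suc k) \<omega> + (M - L - b) / 2 * step k \<omega>) =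
      expectation (gap (Suc k)) + (M - L - b) / 2 * expectation (step k)"
    by (subst Bochner_Integration.integral_add) (use int in \<open>auto intro: int\<close>)
  also have "expectation (\<lambda>\<omega>. gap k \<omega> + err k \<omega> / (2 * b)) = expectation (gap k) + expectation (err k) / (2 * b)"
    by (subst Bochner_Integration.integral_add) (use int in \<open>auto intro: int\<close>)
  finally show ?thesis .
qed

text \<open>
  The part of the new momentum error that depends on the past is
  \<open>(1 - g) (m\<^sub>k - \<nabla>f x\<^sub>k\<^sub>+\<^sub>1)\<close>. Passing from \<open>\<nabla>f x\<^sub>k\<^sub>+\<^sub>1\<close> to \<open>\<nabla>f x\<^sub>k\<close> costs at most \<open>L \<parallel>x\<^sub>k\<^sub>+\<^sub>1 - x\<^sub>k\<parallel>\<close>.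
\<close>
lemma norm_momentum_drift_sq_le:
  "(norm ((1 - g) *\<^sub>R (m k \<omega> - gradient f (x (Suc k) \<omega>))))\<^sup>2
    \<le> (1 - g) * err k \<omega> + (1 - g)\<^sup>2 / g * L\<^sup>2 * step k \<omega>"
proof -
  define u v where "u = m k \<omega> - gradient f (x k \<omega>)" and
    "v = gradient f (x k \<omega>) - gradient f (x (Suc k) \<omega>)"
  have "(norm ((1 - g) *\<^sub>R (u + v)))\<^sup>2 \<le> (norm ((1 - g) *\<^sub>R u))\<^sup>2 / (1 - g) + (norm ((1 - g) *\<^sub>R v))\<^sup>2 / (1 - (1 - g))"
    unfolding scaleR_add_right by (rule norm_add_sq_le_weighted) (use g_pos g_less_1 in auto)
  also have "\<dots> = (1 - g) * (norm u)\<^sup>2 + (1 - g)\<^sup>2 / g * (norm v)\<^sup>2"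
    using g_less_1 by (simp add: power_mult_distrib power2_eq_square)
  also have "\<dots> \<le> (1 - g) * (norm u)\<^sup>2 + (1 - g)\<^sup>2 / g * (L * norm (x (Suc k) \<omega> - x k \<omega>))\<^sup>2"
  proof (intro add_left_mono mult_left_mono power_mono)
    show "norm v \<le> L * norm (x (Suc k) \<omega> - x k \<omega>)"
      using smooth unfolding smooth_with_def v_def by (metis norm_minus_commute)
  qed (use g_pos in auto)
  finally show ?thesis
    by (simp add: u_def v_def power_mult_distrib mult.assoc)
qed

text \<open>
  The past is \<open>(x\<^sub>0, \<dots>, x\<^sub>k\<^sub>+\<^sub>1, m\<^sub>-\<^sub>1, \<dots>, m\<^sub>k)\<close>. With the past fixed, the new error is a constant vector
  plus \<open>g\<close> times the centred stochastic gradient at the known point \<open>x\<^sub>k\<^sub>+\<^sub>1\<close>. Working in \<open>[0, \<infinity>]\<close> yields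
  finiteness of the new error together with the bound.
\<close>
lemma momentum_error_recursion:
  assumes k: "Suc k < K" and err: "integrable P (err k)" and step: "integrable P (step k)"
  shows "integrable P (err (Suc k))"
    and "expectation (err (Suc k)) \<le>
      (1 - g) * expectation (err k) + (1 - g)\<^sup>2 / g * L\<^sup>2 * expectation (step k) + g\<^sup>2 * \<sigma>\<^sup>2"
proof -
  let ?H = "history_space {..Suc k} {..k} :: ((nat \<Rightarrow> 'a) \<times> 'a \<times> (nat \<Rightarrow> 'a)) measure"
  let ?Y = "history {..Suc k} {..k} x m_init m"
  let ?bound = "(1 - g) * expectation (err k) + (1 - g)\<^sup>2 / g * L\<^sup>2 * expectation (step k) + g\<^sup>2 * \<sigma>\<^sup>2"
  have ind: "independent_rv P D (\<xi> (Suc k)) ?H ?Y" and distr_\<xi>: "distr P D (\<xi> (Suc k)) = D"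
    using run k by (auto simp: momentum_run_def m_eq)
  have "prob_space D" using unbiased by (simp add: unbiased_oracle_def)
  \<comment> \<open>The squared new error as a function of the sample \<open>s\<close> and of the past, with iterates \<open>y\<close> and momenta \<open>\<mu>\<close>.\<close>
  define h where "h = (\<lambda>(s, y, _ :: 'a, \<mu>). ennreal ((norm ((1 - g) *\<^sub>R (\<mu> k - gradient f (y (Suc k)))
    + g *\<^sub>R (G (y (Suc k)) s - gradient f (y (Suc k)))))\<^sup>2))"
  have h: "h \<in> borel_measurable (D \<Otimes>\<^sub>M ?H)"
    unfolding h_def history_space_def by measurable
  have m_Suc: "m (Suc k) \<omega> - gradient f (x (Suc k) \<omega>) =
      (1 - g) *\<^sub>R (m k \<omega> - gradient f (x (Suc k) \<omega>))
      + g *\<^sub>R (G (x (Suc k) \<omega>) (\<xi> (Suc k) \<omega>) - gradient f (x (Suc k) \<omega>))" for \<omega>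
    unfolding m_eq using \<gamma>_eq[of k] k by (simp add: algebra_simps)
  have "(\<integral>\<^sup>+\<omega>. ennreal (err (Suc k) \<omega>) \<partial>P) = (\<integral>\<^sup>+\<omega>. h (\<xi> (Suc k) \<omega>, ?Y \<omega>) \<partial>P)"
    unfolding m_Suc by (simp add: h_def history_def)
  also have "\<dots> = (\<integral>\<^sup>+\<omega>. \<integral>\<^sup>+s. h (s, ?Y \<omega>) \<partial>D \<partial>P)"
    using independent_rv_nn_integral[OF prob_space_axioms ind h] by (simp add: distr_\<xi>)
  also have "\<dots> \<le> (\<integral>\<^sup>+\<omega>. ennreal ((1 - g) * err k \<omega> + (1 - g)\<^sup>2 / g * L\<^sup>2 * step k \<omega> + g\<^sup>2 * \<sigma>\<^sup>2) \<partial>P)"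
  proof (rule nn_integral_mono)
    fix \<omega>
    have "(\<integral>\<^sup>+s. h (s, ?Y \<omega>) \<partial>D) = mean_sq D (\<lambda>s. (1 - g) *\<^sub>R (m k \<omega> - gradient f (x (Suc k) \<omega>))
        + g *\<^sub>R (G (x (Suc k) \<omega>) s - gradient f (x (Suc k) \<omega>)))"
      by (simp add: mean_sq_def h_def history_def)
    also have "\<dots> \<le> ennreal ((norm ((1 - g) *\<^sub>R (m k \<omega> - gradient f (x (Suc k) \<omega>))))\<^sup>2 + g\<^sup>2 * \<sigma>\<^sup>2)"
      using unbiased by (intro mean_sq_add_centered_le \<open>prob_space D\<close>) (auto simp: unbiased_oracle_def)
    also have "\<dots> \<le> ennreal ((1 - g) * err k \<omega> + (1 - g)\<^sup>2 / g * L\<^sup>2 * step k \<omega> + g\<^sup>2 * \<sigma>\<^sup>2)"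
      using norm_momentum_drift_sq_le[of k \<omega>] by (intro ennreal_leI) simp
    finally show "(\<integral>\<^sup>+s. h (s, ?Y \<omega>) \<partial>D) \<le> ennreal ((1 - g) * err k \<omega> + (1 - g)\<^sup>2 / g * L\<^sup>2 * step k \<omega> + g\<^sup>2 * \<sigma>\<^sup>2)" .
  qed
  also have "\<dots> = ennreal (expectation (\<lambda>\<omega>. (1 - g) * err k \<omega> + (1 - g)\<^sup>2 / g * L\<^sup>2 * step k \<omega> + g\<^sup>2 * \<sigma>\<^sup>2))"
    using err step g_pos g_less_1 by (intro nn_integral_eq_integral) auto
  also have "expectation (\<lambda>\<omega>. (1 - g) * err k \<omega> + (1 - g)\<^sup>2 / g * L\<^sup>2 * step k \<omega> + g\<^sup>2 * \<sigma>\<^sup>2) = ?bound"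
    using err step by (simp add: prob_space)
  finally have bound: "(\<integral>\<^sup>+\<omega>. ennreal (err (Suc k) \<omega>) \<partial>P) \<le> ennreal ?bound" .
  have [measurable]: "m (Suc k) \<in> borel_measurable P" "x (Suc k) \<in> borel_measurable P"
    using k by auto
  show int: "integrable P (err (Suc k))"
    using bound by (intro integrableI_bounded) (auto intro: le_less_trans)
  have "0 \<le> ?bound" using g_pos g_less_1 by simp
  then show "expectation (err (Suc k)) \<le> ?bound"
    using bound int by (simp add: nn_integral_eq_integral)
qed

lemma integrable_gap_err: "k < K \<Longrightarrow> integrable P (gap k) \<and> integrable P (err k)"
proof (induction k)
  case 0
  have x0: "x 0 \<omega> = x0" if "\<omega> \<in> space P" for \<omega>
    using run that by (simp add: momentum_run_def)
  have "integrable P (err 0) \<longleftrightarrow> integrable P (\<lambda>\<omega>. (norm (m 0 \<omega> - gradient f x0))\<^sup>2)"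
    by (rule Bochner_Integration.integrable_cong) (simp_all add: x0)
  moreover have "integrable P (gap 0) \<longleftrightarrow> integrable P (\<lambda>_. f x0 + \<psi> x0 - Fstar)"
    by (rule Bochner_Integration.integrable_cong) (simp_all add: x0)
  ultimately show ?case using initial_error by simp
next
  case (Suc k)
  then have k: "k < K" and int: "integrable P (gap k)" "integrable P (err k)" by auto
  show ?case
    using integrable_gap_step[OF k int] momentum_error_recursion(1)[OF Suc.prems int(2)] by blast
qed

lemma integrable_step: "k < K \<Longrightarrow> integrable P (step k)"
  using integrable_gap_err integrable_gap_step by blast

text \<open>
  Here \<open>\<nabla>F x\<^sub>k\<^sub>+\<^sub>1\<close> is the sum of the model gradient, the momentum error \<open>\<nabla>f x\<^sub>k - m\<^sub>k\<close>, and
  \<open>\<nabla>f x\<^sub>k\<^sub>+\<^sub>1 - \<nabla>f x\<^sub>k - M (x\<^sub>k\<^sub>+\<^sub>1 - x\<^sub>k)\<close>, whose norm is at most \<open>(M + L) \<parallel>x\<^sub>k\<^sub>+\<^sub>1 - x\<^sub>k\<parallel>\<close>. The weights are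
  \<open>4\<close>, \<open>4\<close>, \<open>2\<close>, with reciprocals summing to \<open>1\<close>.
\<close>
lemma mean_sq_gradient_le:
  assumes k: "k < K" and "0 \<le> S"
    and stationary: "mean_sq P (\<lambda>\<omega>. gradient (prox_model \<psi> M (m k \<omega>) (x k \<omega>)) (x (Suc k) \<omega>))
      \<le> ennreal (M\<^sup>2 / 16) * mean_sq P (\<lambda>\<omega>. x (Suc k) \<omega> - x k \<omega>) + ennreal S"
  shows "mean_sq P (\<lambda>\<omega>. gradient (\<lambda>y. f y + \<psi> y) (x (Suc k) \<omega>))
    \<le> ennreal (4 * S + (M\<^sup>2 / 4 + 2 * (M + L)\<^sup>2) * expectation (step k) + 4 * expectation (err k))"
proof -
  have [measurable]: "x k \<in> borel_measurable P" "x (Suc k) \<in> borel_measurable P" "m k \<in> borel_measurable P"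
    using k by auto
  have int: "integrable P (step k)" "integrable P (err k)"
    using k integrable_step integrable_gap_err by auto
  define r where "r \<omega> = gradient (prox_model \<psi> M (m k \<omega>) (x k \<omega>)) (x (Suc k) \<omega>)" for \<omega>
  have r_eq: "r = (\<lambda>\<omega>. m k \<omega> + gradient \<psi> (x (Suc k) \<omega>) + M *\<^sub>R (x (Suc k) \<omega> - x k \<omega>))"
    unfolding r_def by (simp add: gradient_prox_model \<psi>_diff)
  have [measurable]: "r \<in> borel_measurable P" unfolding r_eq by measurable
  have sq_bound: "(norm (gradient (\<lambda>y. f y + \<psi> y) (x (Suc k) \<omega>)))\<^sup>2
      \<le> 4 * (norm (r \<omega>))\<^sup>2 + (2 * (M + L)\<^sup>2 * step k \<omega> + 4 * err k \<omega>)" for \<omega>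
  proof -
    define v where "v = gradient f (x (Suc k) \<omega>) - gradient f (x k \<omega>) - M *\<^sub>R (x (Suc k) \<omega> - x k \<omega>)"
    define e where "e = gradient f (x k \<omega>) - m k \<omega>"
    have decomp: "gradient (\<lambda>y. f y + \<psi> y) (x (Suc k) \<omega>) = v + (r \<omega> + e)"
      by (simp add: gradient_add f_diff \<psi>_diff r_eq v_def e_def)
    have half: "(norm (a + b))\<^sup>2 \<le> 2 * (norm a)\<^sup>2 + 2 * (norm b)\<^sup>2" for a b :: 'a
      using norm_add_sq_le_weighted[of "1/2" a b] by simp
    have "norm v \<le> norm (gradient f (x (Suc k) \<omega>) - gradient f (x k \<omega>)) + norm (M *\<^sub>R (x (Suc k) \<omega> - x k \<omega>))"
      unfolding v_def by (rule norm_triangle_ineq4)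
    also have "\<dots> \<le> L * norm (x (Suc k) \<omega> - x k \<omega>) + M * norm (x (Suc k) \<omega> - x k \<omega>)"
      using smooth L_pos L_less_M by (intro add_mono) (auto simp: smooth_with_def)
    finally have "(norm v)\<^sup>2 \<le> ((M + L) * norm (x (Suc k) \<omega> - x k \<omega>))\<^sup>2"
      by (intro power_mono) (auto simp: algebra_simps)
    then have "(norm v)\<^sup>2 \<le> (M + L)\<^sup>2 * step k \<omega>" by (simp add: power_mult_distrib)
    moreover have "norm e = norm (m k \<omega> - gradient f (x k \<omega>))"
      by (simp add: e_def norm_minus_commute)
    ultimately show ?thesis
      using half[of v "r \<omega> + e"] half[of "r \<omega>" e] unfolding decomp by simp
  qed
  let ?rest = "2 * (M + L)\<^sup>2 * expectation (step k) + 4 * expectation (err k)"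
  have "mean_sq P (\<lambda>\<omega>. gradient (\<lambda>y. f y + \<psi> y) (x (Suc k) \<omega>))
      \<le> (\<integral>\<^sup>+\<omega>. 4 * ennreal ((norm (r \<omega>))\<^sup>2) + ennreal (2 * (M + L)\<^sup>2 * step k \<omega> + 4 * err k \<omega>) \<partial>P)"
    unfolding mean_sq_def
  proof (rule nn_integral_mono)
    fix \<omega>
    have "4 * ennreal ((norm (r \<omega>))\<^sup>2) = ennreal (4 * (norm (r \<omega>))\<^sup>2)"
      by (subst ennreal_mult) auto
    then show "ennreal ((norm (gradient (\<lambda>y. f y + \<psi> y) (x (Suc k) \<omega>)))\<^sup>2)
        \<le> 4 * ennreal ((norm (r \<omega>))\<^sup>2) + ennreal (2 * (M + L)\<^sup>2 * step k \<omega> + 4 * err k \<omega>)"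
      using ennreal_leI[OF sq_bound[of \<omega>]] by simp
  qed
  also have "\<dots> = 4 * mean_sq P r + ennreal ?rest"
  proof -
    have "(\<integral>\<^sup>+\<omega>. ennreal (2 * (M + L)\<^sup>2 * step k \<omega> + 4 * err k \<omega>) \<partial>P) =
        ennreal (expectation (\<lambda>\<omega>. 2 * (M + L)\<^sup>2 * step k \<omega> + 4 * err k \<omega>))"
      using int by (intro nn_integral_eq_integral) auto
    also have "expectation (\<lambda>\<omega>. 2 * (M + L)\<^sup>2 * step k \<omega> + 4 * err k \<omega>) = ?rest"
      using int by simp
    finally show ?thesis
      unfolding mean_sq_def by (simp add: nn_integral_add nn_integral_cmult)
  qed
  also have "mean_sq P r \<le> ennreal (M\<^sup>2 / 16 * expectation (step k) + S)"
  proof -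
    have "mean_sq P (\<lambda>\<omega>. x (Suc k) \<omega> - x k \<omega>) = ennreal (expectation (step k))"
      unfolding mean_sq_def using int by (intro nn_integral_eq_integral) auto
    then have "mean_sq P r \<le> ennreal (M\<^sup>2 / 16) * ennreal (expectation (step k)) + ennreal S"
      using stationary by (simp add: r_def[abs_def])
    also have "\<dots> = ennreal (M\<^sup>2 / 16 * expectation (step k) + S)"
      using \<open>0 \<le> S\<close> by (subst ennreal_mult[symmetric]) (auto simp: ennreal_plus)
    finally show ?thesis .
  qed
  also have "4 * ennreal (M\<^sup>2 / 16 * expectation (step k) + S) + ennreal ?rest =
      ennreal (4 * S + (M\<^sup>2 / 4 + 2 * (M + L)\<^sup>2) * expectation (step k) + 4 * expectation (err k))"
  proof -
    have "4 * ennreal (M\<^sup>2 / 16 * expectation (step k) + S) = ennreal (4 * (M\<^sup>2 / 16 * expectation (step k) + S))"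
      using \<open>0 \<le> S\<close> by (subst ennreal_mult) auto
    then show ?thesis
      using \<open>0 \<le> S\<close> by (simp add: ennreal_plus[symmetric] algebra_simps del: ennreal_plus)
  qed
  finally show ?thesis by (simp add: add_right_mono mult_left_mono)
qed

text \<open>
  If \<open>M \<ge> 4 L\<close> and \<open>N = M - L\<close>, then \<open>M \<le> 4/3 N\<close> and \<open>M + L \<le> 5/3 N\<close>. Hence the bound on one
  squared gradient is at most \<open>4 S\<^sub>k\<close> plus \<open>75 N\<close> times the decrease \<open>2/25 N r\<^sub>k + e\<^sub>k / (5 N)\<close> of the
  potential in that iteration, noise aside.
\<close>

lemma sum_mean_sq_gradient_le:
  assumes M: "4 * L \<le> M" and g: "g = sqrt (152 / 17) * L / (M - L)"
    and S: "\<And>k. k < K \<Longrightarrow> 0 \<le> S k"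
    and stationary: "\<And>k. k < K \<Longrightarrow>
      mean_sq P (\<lambda>\<omega>. gradient (prox_model \<psi> M (m k \<omega>) (x k \<omega>)) (x (Suc k) \<omega>))
        \<le> ennreal (M\<^sup>2 / 16) * mean_sq P (\<lambda>\<omega>. x (Suc k) \<omega> - x k \<omega>) + ennreal (S k)"
  shows "(\<Sum>k<K. mean_sq P (\<lambda>\<omega>. gradient (\<lambda>y. f y + \<psi> y) (x (Suc k) \<omega>)))
    \<le> ennreal (4 * (\<Sum>k<K. S k) + 75 * (M - L) *
        (initial_potential P f \<psi> Fstar L x0 (m 0) + real K * (16 / 5 * L * \<sigma>\<^sup>2 / (M - L)\<^sup>2)))"
proof -
  define N where "N = M - L"
  have N: "3 * L \<le> N" "0 < N" using M L_pos by (auto simp: N_def)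
  let ?a = "\<lambda>k. 2 / 25 * N * expectation (step k) + expectation (err k) / (5 * N)"
  have term_le: "mean_sq P (\<lambda>\<omega>. gradient (\<lambda>y. f y + \<psi> y) (x (Suc k) \<omega>)) \<le> ennreal (4 * S k + 75 * N * ?a k)"
    if k: "k < K" for k
  proof -
    have "M\<^sup>2 \<le> (4 / 3 * N)\<^sup>2" "(M + L)\<^sup>2 \<le> (5 / 3 * N)\<^sup>2"
      using M L_pos by (auto intro!: power_mono simp: N_def)
    then have "M\<^sup>2 / 4 + 2 * (M + L)\<^sup>2 \<le> 6 * N\<^sup>2"
      by (simp add: power2_eq_square)
    then have "(M\<^sup>2 / 4 + 2 * (M + L)\<^sup>2) * expectation (step k) \<le> 6 * N\<^sup>2 * expectation (step k)"
      by (intro mult_right_mono) auto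
    moreover have "4 * expectation (err k) \<le> 15 * expectation (err k)"
      by (intro mult_right_mono) auto
    moreover have "75 * N * ?a k = 6 * N\<^sup>2 * expectation (step k) + 15 * expectation (err k)"
      using N by (simp add: field_simps power2_eq_square)
    ultimately show ?thesis
      by (intro order_trans[OF mean_sq_gradient_le[OF k S[OF k] stationary[OF k]]] ennreal_leI) linarith
  qed
  have a_nonneg: "0 \<le> ?a k" for k using N by simp
  have initial: "expectation (gap 0) + sqrt (19 / 156) * expectation (err 0) / L =
      initial_potential P f \<psi> Fstar L x0 (m 0)"
  proof -
    have x0: "x 0 \<omega> = x0" if "\<omega> \<in> space P" for \<omega>
      using run that by (simp add: momentum_run_def)
    have "expectation (gap 0) = expectation (\<lambda>_. f x0 + \<psi> x0 - Fstar)"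
      by (rule Bochner_Integration.integral_cong) (simp_all add: x0)
    moreover have "expectation (err 0) = expectation (\<lambda>\<omega>. (norm (m 0 \<omega> - gradient f x0))\<^sup>2)"
      by (rule Bochner_Integration.integral_cong) (simp_all add: x0)
    ultimately show ?thesis by (simp add: initial_potential_def prob_space)
  qed
  have "(\<Sum>k<K. mean_sq P (\<lambda>\<omega>. gradient (\<lambda>y. f y + \<psi> y) (x (Suc k) \<omega>)))
      \<le> (\<Sum>k<K. ennreal (4 * S k + 75 * N * ?a k))"
    by (intro sum_mono term_le) simp
  also have "\<dots> = ennreal (\<Sum>k<K. 4 * S k + 75 * N * ?a k)"
    using S N a_nonneg by (intro sum_ennreal add_nonneg_nonneg mult_nonneg_nonneg) auto
  also have "(\<Sum>k<K. 4 * S k + 75 * N * ?a k) = 4 * (\<Sum>k<K. S k) + 75 * N * (\<Sum>k<K. ?a k)"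
    unfolding sum.distrib[of "\<lambda>k. 4 * S k"] by (simp only: sum_distrib_left)
  also have "(\<Sum>k<K. ?a k) \<le>
      initial_potential P f \<psi> Fstar L x0 (m 0) + real K * (16 / 5 * L * \<sigma>\<^sup>2 / N\<^sup>2)"
    unfolding initial[symmetric]
  proof (rule potential_telescoping[OF L_pos N(1)])
    show "g = sqrt (152 / 17) * L / N" by (simp add: g N_def)
    show "0 \<le> expectation (gap k)" for k by (intro Bochner_Integration.integral_nonneg gap_nonneg)
    show "0 \<le> expectation (err k)" "0 \<le> expectation (step k)" for k by auto
    show "expectation (gap (Suc k)) + N / 5 * expectation (step k)
        \<le> expectation (gap k) + 5 / 6 * expectation (err k) / N" if "k < K" for k
      \<comment> \<open>The share \<open>b = 3/5 N\<close> leaves \<open>N / 5\<close> in front of the step and costs \<open>5/6 err / N\<close>.\<close>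
      using mean_gap_decrease[OF that, of "3 / 5 * N"] integrable_gap_err[OF that] N
      by (simp add: N_def[symmetric] field_simps)
    show "expectation (err (Suc k)) \<le> (1 - g) * expectation (err k)
        + (1 - g)\<^sup>2 / g * L\<^sup>2 * expectation (step k) + g\<^sup>2 * \<sigma>\<^sup>2" if "Suc k < K" for k
      using that integrable_gap_err[of k] integrable_step[of k]
      by (intro momentum_error_recursion(2)) auto
  qed
  finally show ?thesis
    using N by (simp add: N_def ennreal_leI add_left_mono mult_left_mono del: ennreal_plus)
qed

end

section \<open>Convergence after a prescribed number of iterations\<close>

theorem theorem3:
  fixes f \<psi> :: "real ^ 'n \<Rightarrow> real"
    and L \<sigma> \<epsilon> Fstar \<Phi>0 :: real
    and D :: "'s measure"
    and G :: "real ^ 'n \<Rightarrow> 's \<Rightarrow> real ^ 'n"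
    and x0 :: "real ^ 'n"
  assumes "L > 0" and "\<sigma> \<ge> 0" and "\<epsilon> > 0"
    and "\<forall>x. f differentiable (at x)" and "\<forall>x. \<psi> differentiable (at x)"
    and "\<forall>x. Fstar \<le> f x + \<psi> x"
    and "smooth_with L f"
    and "unbiased_oracle D G f \<sigma>"
    and "\<Phi>0 > 0"
  shows "\<exists>K::nat. 1 \<le> K \<and>
    int K \<le> \<lceil>iteration_constant * (L * \<Phi>0 * \<sigma>\<^sup>2 / \<epsilon>\<^sup>2 + L * \<Phi>0 / \<epsilon>)\<rceil> \<and>
    (\<forall>(P :: 'w measure) g_init m_init \<xi> x M \<gamma> m S t.
      M = 4 * L + sqrt (8 * real K * L * \<sigma>\<^sup>2 / \<Phi>0) \<longrightarrow>
      (\<forall>k<K. \<gamma> k = sqrt (152 / 17) * L / (M - L)) \<longrightarrow>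
      m = momentum G g_init \<gamma> m_init \<xi> x \<longrightarrow>
      momentum_run P D G K g_init \<gamma> x0 m_init \<xi> x \<longrightarrow>
      integrable P (\<lambda>\<omega>. (norm (m 0 \<omega> - gradient f x0))\<^sup>2) \<longrightarrow>
      \<Phi>0 = initial_potential P f \<psi> Fstar L x0 (m 0) \<longrightarrow>
      (\<forall>k<K. AE \<omega> in P.
        prox_model \<psi> M (m k \<omega>) (x k \<omega>) (x (Suc k) \<omega>)
          \<le> prox_model \<psi> M (m k \<omega>) (x k \<omega>) (x k \<omega>)) \<longrightarrow>
      (\<forall>k<K. 0 \<le> S k) \<longrightarrow>
      (\<forall>k<K.
        mean_sq P (\<lambda>\<omega>. gradient (prox_model \<psi> M (m k \<omega>) (x k \<omega>)) (x (Suc k) \<omega>))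
          \<le> ennreal (M\<^sup>2 / 16) * mean_sq P (\<lambda>\<omega>. x (Suc k) \<omega> - x k \<omega>) + ennreal (S k)) \<longrightarrow>
      uniform_independent_index P D K x m_init m \<xi> t \<longrightarrow>
      mean_sq P (\<lambda>\<omega>. gradient (\<lambda>y. f y + \<psi> y) (x (t \<omega>) \<omega>))
        \<le> ennreal (\<epsilon> / 2 + 8 / real K * (\<Sum>k<K. S k)) \<and>
      ((\<forall>k<K. S k \<le> \<epsilon> / 16) \<longrightarrow>
        mean_sq P (\<lambda>\<omega>. gradient (\<lambda>y. f y + \<psi> y) (x (t \<omega>) \<omega>)) \<le> ennreal \<epsilon>))"
proof -
  define K where "K = nat \<lceil>iteration_constant * (L * \<Phi>0 * \<sigma>\<^sup>2 / \<epsilon>\<^sup>2 + L * \<Phi>0 / \<epsilon>)\<rceil>"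
  have "0 < iteration_constant * (L * \<Phi>0 * \<sigma>\<^sup>2 / \<epsilon>\<^sup>2 + L * \<Phi>0 / \<epsilon>)"
    using \<open>L > 0\<close> \<open>\<epsilon> > 0\<close> \<open>\<Phi>0 > 0\<close> unfolding iteration_constant_def
    by (intro mult_pos_pos add_nonneg_pos) auto
  then have K: "1 \<le> K" "int K \<le> \<lceil>iteration_constant * (L * \<Phi>0 * \<sigma>\<^sup>2 / \<epsilon>\<^sup>2 + L * \<Phi>0 / \<epsilon>)\<rceil>"
    and K_ge: "iteration_constant * (L * \<Phi>0 * \<sigma>\<^sup>2 / \<epsilon>\<^sup>2 + L * \<Phi>0 / \<epsilon>) \<le> real K"
    unfolding K_def by linarith+
  show ?thesis
  proof (intro exI[of _ K] conjI allI impI K)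
    fix P :: "'w measure" and g_init m_init \<xi> x M \<gamma> m S t
    assume M: "M = 4 * L + sqrt (8 * real K * L * \<sigma>\<^sup>2 / \<Phi>0)"
      and \<gamma>: "\<forall>k<K. \<gamma> k = sqrt (152 / 17) * L / (M - L)"
      and m: "m = momentum G g_init \<gamma> m_init \<xi> x"
      and run: "momentum_run P D G K g_init \<gamma> x0 m_init \<xi> x"
      and init: "integrable P (\<lambda>\<omega>. (norm (m 0 \<omega> - gradient f x0))\<^sup>2)"
      and \<Phi>0: "\<Phi>0 = initial_potential P f \<psi> Fstar L x0 (m 0)"
      and decrease: "\<forall>k<K. AE \<omega> in P. prox_model \<psi> M (m k \<omega>) (x k \<omega>) (x (Suc k) \<omega>)
          \<le> prox_model \<psi> M (m k \<omega>) (x k \<omega>) (x k \<omega>)"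
      and S: "\<forall>k<K. 0 \<le> S k"
      and stationary: "\<forall>k<K.
        mean_sq P (\<lambda>\<omega>. gradient (prox_model \<psi> M (m k \<omega>) (x k \<omega>)) (x (Suc k) \<omega>))
          \<le> ennreal (M\<^sup>2 / 16) * mean_sq P (\<lambda>\<omega>. x (Suc k) \<omega> - x k \<omega>) + ennreal (S k)"
      and t: "uniform_independent_index P D K x m_init m \<xi> t"
    define g where "g = sqrt (152 / 17) * L / (M - L)"
    have M_ge: "4 * L \<le> M"
      using \<open>L > 0\<close> \<open>\<Phi>0 > 0\<close> by (simp add: M)
    have "sqrt (152 / 17) < 3" by (rule real_less_lsqrt) auto
    from mult_strict_right_mono[OF this \<open>L > 0\<close>] have "sqrt (152 / 17) * L < M - L"
      using M_ge by linarith
    then have g: "0 < g" "g < 1"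
      using M_ge \<open>L > 0\<close> by (auto simp: g_def)
    have "prob_space P" using run by (simp add: momentum_run_def)
    interpret prox_momentum_run P D G f \<psi> L \<sigma> Fstar M K g_init g \<gamma> x0 m_init \<xi> x m
      unfolding prox_momentum_run_def prox_momentum_run_axioms_def
      using assms \<open>prob_space P\<close> g M_ge \<gamma> m run init decrease by (auto simp: g_def)
    let ?grad = "gradient (\<lambda>y. f y + \<psi> y)"
    have [measurable]: "?grad \<in> borel_measurable borel"
      using f_diff \<psi>_diff by (intro borel_measurable_gradient differentiable_add) auto
    let ?bound = "75 * (M - L) * (\<Phi>0 + real K * (16 / 5 * L * \<sigma>\<^sup>2 / (M - L)\<^sup>2))"
    have S_nonneg: "0 \<le> (\<Sum>k<K. S k)" using S by (intro sum_nonneg) auto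
    have "mean_sq P (\<lambda>\<omega>. ?grad (x (t \<omega>) \<omega>)) = (\<Sum>k<K. mean_sq P (\<lambda>\<omega>. ?grad (x (Suc k) \<omega>))) / of_nat K"
      by (rule mean_sq_uniform_index[OF \<open>prob_space P\<close> t K(1)]) measurable
    also have "\<dots> \<le> ennreal (4 * (\<Sum>k<K. S k) + ?bound) / of_nat K"
      unfolding \<Phi>0 using S stationary
      by (intro divide_right_mono_ennreal sum_mean_sq_gradient_le M_ge) (auto simp: g_def)
    also have "\<dots> = ennreal ((4 * (\<Sum>k<K. S k) + ?bound) / real K)"
      using K(1) S_nonneg M_ge \<open>L > 0\<close> \<open>\<Phi>0 > 0\<close>
      by (subst divide_ennreal[symmetric]) (auto simp: ennreal_of_nat_eq_real_of_nat)
    also have "\<dots> \<le> ennreal (\<epsilon> / 2 + 8 / real K * (\<Sum>k<K. S k))"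
    proof (rule ennreal_leI)
      have "?bound / real K \<le> \<epsilon> / 2"
        using iteration_count_suffices[OF \<open>L > 0\<close> \<open>\<Phi>0 > 0\<close> \<open>\<epsilon> > 0\<close> K(1) K_ge, of "M - L"] by (simp add: M)
      moreover have "4 * (\<Sum>k<K. S k) / real K \<le> 8 / real K * (\<Sum>k<K. S k)"
        using S_nonneg by (simp add: divide_right_mono)
      ultimately show "(4 * (\<Sum>k<K. S k) + ?bound) / real K \<le> \<epsilon> / 2 + 8 / real K * (\<Sum>k<K. S k)"
        unfolding add_divide_distrib by linarith
    qed
    finally show bound: "mean_sq P (\<lambda>\<omega>. ?grad (x (t \<omega>) \<omega>)) \<le> ennreal (\<epsilon> / 2 + 8 / real K * (\<Sum>k<K. S k))" .
    show "mean_sq P (\<lambda>\<omega>. ?grad (x (t \<omega>) \<omega>)) \<le> ennreal \<epsilon>" if small: "\<forall>k<K. S k \<le> \<epsilon> / 16"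
    proof (rule order_trans[OF bound ennreal_leI])
      have "(\<Sum>k<K. S k) \<le> (\<Sum>k<K. \<epsilon> / 16)" using small by (intro sum_mono) auto
      then have "8 / real K * (\<Sum>k<K. S k) \<le> 8 / real K * (real K * (\<epsilon> / 16))"
        by (intro mult_left_mono) auto
      then show "\<epsilon> / 2 + 8 / real K * (\<Sum>k<K. S k) \<le> \<epsilon>"
        using K(1) by simp
    qed
  qed
qed

end
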